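(* For every $p\ge\frac{1}{\sqrt n}$ there exists an $n$-player one-round communication protocol that distinguishes $\boldsymbol D_0$ from $\boldsymbol D_1$ with high probability in which every message has $O((\log\log n)(\log\log\log n))$ bits.
   Context: Needle problem with domain $[t]$, $t=\Omega(n)$, and $n$ samples. $\boldsymbol D_0$: $X_1,\dots,X_n$ i.i.d. uniform on $[t]$. $\boldsymbol D_1$: pick $\alpha$ uniformly from $[t]$; independently for each $i$, $X_i=\alpha$ with probability $p$, otherwise uniform on $[t]$. In the $n$-player one-round (one-way) communication model, player $i$ holds $X_i$ and knows its index $i$; players speak once each in the order $1,2,\dots,n$, player $i$ sending a message to player $i+1$ based on its input and the message received; shared public randomness is available and is not counted; the last player outputs the answer. The space is the maximum message length. *)

theory Defs
  imports "HOL-Probability.Probability"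
begin

text \<open>Players are indexed 0..n-1 (player k here is player k+1 of the paper).
  Inputs: x :: nat \<Rightarrow> nat, with x k the sample of player k; domain [t] = {1..t}.
  Public randomness: a seed r drawn from a distribution R :: nat pmf (for fixed n,t
  and bounded message length there are only finitely many deterministic protocols,
  so a finitely supported mixture is fully general).
  msg r k m v : message sent by player k, given seed r, its index k, the received
  message m (empty for the first player) and its input v.
  out r m v : answer of the last player (True = "D1").\<close>

primrec transcript ::
  "(nat \<Rightarrow> nat \<Rightarrow> bool list \<Rightarrow> nat \<Rightarrow> bool list) \<Rightarrow> nat \<Rightarrow> (nat \<Rightarrow> nat) \<Rightarrow> nat \<Rightarrow> bool list" where
  "transcript msg r x 0 = []"
| "transcript msg r x (Suc k) = msg r k (transcript msg r x k) (x k)"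

definition protocol_output ::
  "nat \<Rightarrow> (nat \<Rightarrow> nat \<Rightarrow> bool list \<Rightarrow> nat \<Rightarrow> bool list) \<Rightarrow> (nat \<Rightarrow> bool list \<Rightarrow> nat \<Rightarrow> bool)
   \<Rightarrow> nat \<Rightarrow> (nat \<Rightarrow> nat) \<Rightarrow> bool" where
  "protocol_output n msg out r x = out r (transcript msg r x (n - 1)) (x (n - 1))"

definition messages_bounded ::
  "nat \<Rightarrow> nat \<Rightarrow> (nat \<Rightarrow> nat \<Rightarrow> bool list \<Rightarrow> nat \<Rightarrow> bool list) \<Rightarrow> real \<Rightarrow> bool" where
  "messages_bounded n t msg L \<longleftrightarrow>
     (\<forall>r x. (\<forall>i<n. x i \<in> {1..t}) \<longrightarrow>
        (\<forall>k. 1 \<le> k \<and> k < n \<longrightarrow> real (length (transcript msg r x k)) \<le> L))"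

definition D0 :: "nat \<Rightarrow> nat \<Rightarrow> (nat \<Rightarrow> nat) pmf" where
  "D0 n t = Pi_pmf {..<n} 0 (\<lambda>i. pmf_of_set {1..t})"

definition D1 :: "nat \<Rightarrow> nat \<Rightarrow> real \<Rightarrow> (nat \<Rightarrow> nat) pmf" where
  "D1 n t p = bind_pmf (pmf_of_set {1..t}) (\<lambda>\<alpha>.
      Pi_pmf {..<n} 0 (\<lambda>i. bind_pmf (bernoulli_pmf p)
         (\<lambda>b. if b then return_pmf \<alpha> else pmf_of_set {1..t})))"

end

theory Submission
  imports Defs "HOL-Real_Asymp.Real_Asymp"
begin

text \<open>The protocol is deterministic.  With \<open>s\<close> about \<open>sqrt n\<close>, the players are cut into blocks of
  length \<open>L * s\<close> and the domain into \<open>16 * s\<close> residue classes.  A trial picks a class and counts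
  its hits: the class of the needle receives at least \<open>L\<close> expected hits per block, any other class
  at most \<open>L / 8\<close>.  At the end of each block the trial is abandoned if it has fewer than \<open>L / 2\<close>
  hits per block so far; since this kills a wrong trial after \<open>a\<close> blocks with probability
  \<open>1 - exp (- \<Omega>(a * L))\<close>, a wrong trial usually costs a single block, and surviving \<open>O(ln n)\<close>
  blocks is conclusive evidence.  Hence \<open>O(L)\<close> parallel copies, each holding an age and a counter of
  \<open>O(log log n)\<close> bits, have time to try every class once.  The error under \<open>D1\<close> is
  \<open>exp (- \<Omega>(L))\<close>, so it suffices to let \<open>L\<close> grow like \<open>log log log n\<close>.\<close>

section \<open>Finite-state machines as one-round protocols\<close>

text \<open>The states embed injectively into the bit strings of length exactly \<open>l\<close>;
  each player decodes the state, advances it by its own sample and encodes the result. The seed is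
  ignored, so the protocol is deterministic.\<close>

lemma finite_state_protocol:
  fixes step :: "nat \<Rightarrow> 's \<Rightarrow> nat \<Rightarrow> 's" and st :: "(nat \<Rightarrow> nat) \<Rightarrow> nat \<Rightarrow> 's"
  assumes fin: "finite S" and card: "card S \<le> 2 ^ l"
    and init: "\<And>x. st x 0 = s0"
    and step: "\<And>x k. st x (Suc k) = step k (st x k) (x k)"
    and inS: "\<And>x k. st x k \<in> S"
    and n: "n \<ge> 2"
  shows "\<exists>msg out. messages_bounded n t msg (real l) \<and>
           (\<forall>r x. protocol_output n msg out r x \<longleftrightarrow> F (st x (n - 1)))"
proof -
  have cl: "card {m :: bool list. length m = l} = 2 ^ l"
    using card_lists_length_eq[of "UNIV :: bool set" l] by simp
  have "finite {m :: bool list. length m = l}"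
    using finite_lists_length_eq[of "UNIV :: bool set" l] by simp
  then obtain enc where enc: "enc ` S \<subseteq> {m :: bool list. length m = l}" "inj_on enc S"
    using card_le_inj[OF fin] card cl by metis
  \<comment> \<open>The first player receives the empty string, which need not encode
    \<open>s0\<close>; player 0 therefore starts from \<open>s0\<close> directly.\<close>
  define msg where "msg = (\<lambda>(r::nat) k m v. enc (step k (if k = 0 then s0 else inv_into S enc m) v))"
  define out where "out = (\<lambda>(r::nat) m (v::nat). F (inv_into S enc m))"
  have tr: "transcript msg r x (Suc k) = enc (st x (Suc k))" for r x k
  proof (induction k)
    case 0
    show ?case by (simp add: msg_def init step)
  next
    case (Suc k)
    have "transcript msg r x (Suc (Suc k)) = msg r (Suc k) (enc (st x (Suc k))) (x (Suc k))"
      by (simp only: transcript.simps(2)[of _ _ _ "Suc k"] Suc.IH)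
    then show ?case
      by (simp add: msg_def step[of x "Suc k"] inv_into_f_f[OF enc(2) inS])
  qed
  have tr': "transcript msg r x k = enc (st x k)" if "k \<ge> 1" for r x k
    using tr[of r x "k - 1"] that by simp
  have "messages_bounded n t msg (real l)"
    unfolding messages_bounded_def using enc(1) inS by (fastforce simp: tr')
  moreover have "protocol_output n msg out r x \<longleftrightarrow> F (st x (n - 1))" for r x
    using n by (simp add: protocol_output_def out_def tr' inv_into_f_f[OF enc(2) inS])
  ultimately show ?thesis by blast
qed

section \<open>Exponential tail bounds for counts of independent events\<close>

text \<open>Chernoff's method: Markov's inequality for the exponential of the scaled count, whose
  expectation factorises by independence. A positive \<open>c\<close> yields upper tails, a negative
  one lower tails.\<close>

lemma markov_count_Pi_pmf:
  fixes p :: "'i \<Rightarrow> 'a pmf" and c \<rho> m :: real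
  assumes "finite A" "I \<subseteq> A"
    and E: "\<And>i. i \<in> I \<Longrightarrow> measure_pmf.expectation (p i) (\<lambda>v. exp (c * of_bool (P i v))) \<le> exp \<rho>"
  shows "measure_pmf.prob (Pi_pmf A d p) {x. c * real (card {i\<in>I. P i (x i)}) \<ge> m}
           \<le> exp (\<rho> * card I - m)"
proof -
  let ?M = "Pi_pmf A d p"
  have finI: "finite I" using assms finite_subset by blast
  \<comment> \<open>Coordinates outside \<open>I\<close> get the factor 1, so that the product over
    all of \<open>A\<close>, which is what independence evaluates, collapses to
    \<open>I\<close>.\<close>
  define f where "f = (\<lambda>i v. if i \<in> I then exp (c * of_bool (P i v)) else 1 :: real)"
  have f_bd: "norm (f i v) \<le> exp \<bar>c\<bar>" for i v by (auto simp: f_def)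
  have int_f: "integrable (measure_pmf (p i)) (f i)" for i
    by (intro measure_pmf.integrable_const_bound[of _ "exp \<bar>c\<bar>"]) (use f_bd in auto)
  have prod_f: "(\<Prod>i\<in>A. f i (x i)) = exp (c * real (card {i\<in>I. P i (x i)}))" for x
  proof -
    have "(\<Prod>i\<in>A. f i (x i)) = (\<Prod>i\<in>I. exp (c * of_bool (P i (x i))))"
      by (rule prod.mono_neutral_cong_right) (use assms in \<open>auto simp: f_def\<close>)
    also have "\<dots> = exp (\<Sum>i\<in>I. c * of_bool (P i (x i)))"
      by (rule exp_sum[OF finI, symmetric])
    also have "(\<Sum>i\<in>I. c * of_bool (P i (x i))) = c * real (card {i\<in>I. P i (x i)})"
      using finI by (simp add: sum_distrib_left[symmetric] sum_of_bool_eq Int_def)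
    finally show ?thesis .
  qed
  have "measure_pmf.expectation ?M (\<lambda>x. \<Prod>i\<in>A. f i (x i))
      = (\<Prod>i\<in>A. measure_pmf.expectation (p i) (f i))"
    using assms(1) int_f by (intro expectation_prod_Pi_pmf) (auto simp: f_def)
  also have "\<dots> = (\<Prod>i\<in>I. measure_pmf.expectation (p i) (\<lambda>v. exp (c * of_bool (P i v))))"
    by (rule prod.mono_neutral_cong_right) (use assms in \<open>auto simp: f_def\<close>)
  also have "\<dots> \<le> (\<Prod>i\<in>I. exp \<rho>)"
    by (intro prod_mono) (use E in auto)
  also have "\<dots> = exp (\<rho> * card I)"
    by (simp add: exp_of_nat_mult[symmetric] mult.commute)
  finally have EM: "measure_pmf.expectation ?M (\<lambda>x. exp (c * real (card {i\<in>I. P i (x i)}))) \<le> exp (\<rho> * card I)"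
    by (simp add: prod_f)
  have int: "integrable (measure_pmf ?M) (\<lambda>x. exp (c * real (card {i\<in>I. P i (x i)})))"
  proof (intro measure_pmf.integrable_const_bound[of _ "exp (\<bar>c\<bar> * card I)"])
    have "c * real (card {i\<in>I. P i (x i)}) \<le> \<bar>c\<bar> * card I" for x
      by (intro mult_mono) (auto intro: card_mono finI)
    then show "AE x in measure_pmf ?M. norm (exp (c * real (card {i\<in>I. P i (x i)}))) \<le> exp (\<bar>c\<bar> * card I)"
      by simp
  qed simp
  have "measure_pmf.prob ?M {x. exp m \<le> exp (c * real (card {i\<in>I. P i (x i)}))}
      \<le> measure_pmf.expectation ?M (\<lambda>x. exp (c * real (card {i\<in>I. P i (x i)}))) / exp m"
    using integral_Markov_inequality_measure[OF int, of "{}" "exp m"] by simp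
  also have "\<dots> \<le> exp (\<rho> * card I) / exp m"
    using EM by (simp add: divide_right_mono)
  finally show ?thesis by (simp add: exp_diff)
qed

lemma expectation_exp_of_bool:
  "measure_pmf.expectation p (\<lambda>v. exp (c * of_bool (P v))) = 1 + (exp c - 1) * measure_pmf.prob p {v. P v}"
proof -
  have "measure_pmf.expectation p (\<lambda>v. exp (c * of_bool (P v)))
      = measure_pmf.expectation p (\<lambda>v. 1 + (exp c - 1) * indicator {v. P v} v)"
    by (rule arg_cong[where f = "measure_pmf.expectation p"]) (auto simp: indicator_def)
  also have "\<dots> = 1 + (exp c - 1) * measure_pmf.prob p {v. P v}"
    by (subst Bochner_Integration.integral_add) (auto simp: measure_pmf.emeasure_eq_measure)
  finally show ?thesis .
qed

text \<open>The case \<open>c = 1\<close>: since \<open>exp 1 \<le> 3\<close>, the moment is at most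
  \<open>1 + 2 * \<rho>\<close>, hence at most \<open>exp (2 * \<rho>)\<close>.\<close>

lemma count_Pi_pmf_upper_tail:
  assumes "finite A" "I \<subseteq> A" "\<And>i. i \<in> I \<Longrightarrow> measure_pmf.prob (p i) {v. P v} \<le> \<rho>"
  shows "measure_pmf.prob (Pi_pmf A d p) {x. m \<le> real (card {i\<in>I. P (x i)})} \<le> exp (2 * \<rho> * card I - m)"
proof -
  have "measure_pmf.expectation (p i) (\<lambda>v. exp (1 * of_bool (P v))) \<le> exp (2 * \<rho>)" if "i \<in> I" for i
  proof -
    have "(exp 1 - 1) * measure_pmf.prob (p i) {v. P v} \<le> 2 * \<rho>"
      using exp_le assms(3)[OF that] by (intro mult_mono) auto
    then show ?thesis
      unfolding expectation_exp_of_bool using exp_ge_add_one_self[of "2 * \<rho>"] by linarith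
  qed
  from markov_count_Pi_pmf[OF assms(1,2), where P = "\<lambda>_. P", OF this, where m = m and d = d]
  show ?thesis by simp
qed

text \<open>The case \<open>c = -1\<close>: since \<open>exp (- 1) \<le> 2 / 5\<close>, the moment
  is at most \<open>1 - 3 / 5 * \<rho>\<close>. What matters later is that 3/5 exceeds 1/2, so the
  bound decays already for a threshold at half the mean.\<close>

lemma count_Pi_pmf_lower_tail:
  assumes "finite A" "I \<subseteq> A" "\<And>i. i \<in> I \<Longrightarrow> \<rho> \<le> measure_pmf.prob (p i) {v. P v}" "0 \<le> \<rho>"
  shows "measure_pmf.prob (Pi_pmf A d p) {x. real (card {i\<in>I. P (x i)}) \<le> m} \<le> exp (m - 3 / 5 * \<rho> * card I)"
proof -
  have "(5 / 2 :: real) \<le> exp 1"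
    using exp_lower_Taylor_quadratic[of "1 :: real"] by simp
  then have e: "exp (- 1 :: real) \<le> 2 / 5"
    by (simp add: exp_minus field_simps)
  have "measure_pmf.expectation (p i) (\<lambda>v. exp (- 1 * of_bool (P v))) \<le> exp (- (3 / 5 * \<rho>))" if "i \<in> I" for i
  proof -
    have "(3 / 5) * \<rho> \<le> (1 - exp (- 1)) * measure_pmf.prob (p i) {v. P v}"
      using e assms(3)[OF that] assms(4) by (intro mult_mono) auto
    then show ?thesis
      unfolding expectation_exp_of_bool using exp_ge_add_one_self[of "- (3 / 5 * \<rho>)"]
      by (simp add: algebra_simps)
  qed
  from markov_count_Pi_pmf[OF assms(1,2), where P = "\<lambda>_. P", OF this, where m = "- m" and d = d]
  show ?thesis by (simp add: algebra_simps)
qed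

section \<open>Mixtures and residue classes\<close>

lemma prob_bind_pmf:
  "measure_pmf.prob (bind_pmf M N) X = measure_pmf.expectation M (\<lambda>y. measure_pmf.prob (N y) X)"
proof -
  have int: "integrable (measure_pmf M) (\<lambda>y. measure_pmf.prob (N y) X)"
    by (rule measure_pmf.integrable_const_bound[of _ 1]) auto
  have "ennreal (measure_pmf.prob (bind_pmf M N) X) = (\<integral>\<^sup>+y. ennreal (measure_pmf.prob (N y) X) \<partial>measure_pmf M)"
    by (simp flip: measure_pmf.emeasure_eq_measure)
  also have "\<dots> = ennreal (measure_pmf.expectation M (\<lambda>y. measure_pmf.prob (N y) X))"
    by (intro nn_integral_eq_integral int) auto
  finally show ?thesis
    by (simp add: integral_nonneg_AE)
qed

text \<open>Division by \<open>Q\<close> is injective on a residue class, which leaves at most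
  \<open>t / Q + 1\<close> elements; the 1 is absorbed because \<open>Q \<le> t\<close>.\<close>

lemma prob_residue_class_le:
  assumes "0 < Q" "Q \<le> t"
  shows "measure_pmf.prob (pmf_of_set {1..t}) {v. v mod Q = u} \<le> 2 / real Q"
proof -
  have "card ({1..t} \<inter> {v. v mod Q = u}) \<le> card {..t div Q}"
  proof (rule card_inj_on_le)
    show "inj_on (\<lambda>v. v div Q) ({1..t} \<inter> {v. v mod Q = u})"
    proof (rule inj_onI)
      fix v w
      assume "v \<in> {1..t} \<inter> {v. v mod Q = u}" "w \<in> {1..t} \<inter> {v. v mod Q = u}" "v div Q = w div Q"
      then show "v = w"
        using div_mult_mod_eq[of v Q] div_mult_mod_eq[of w Q] by simp
    qed
  qed (auto intro: div_le_mono)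
  then have "real (card ({1..t} \<inter> {v. v mod Q = u})) \<le> real (t div Q) + 1"
    by simp
  also have "\<dots> \<le> real t / real Q + 1"
    by (simp add: of_nat_div_le_of_nat)
  also have "\<dots> \<le> 2 * real t / real Q"
    using assms by (simp add: field_simps)
  finally have "real (card ({1..t} \<inter> {v. v mod Q = u})) / real t \<le> 2 * real t / real Q / real t"
    by (rule divide_right_mono) simp
  then show ?thesis
    using assms by (simp add: measure_pmf_of_set)
qed

lemma prob_bernoulli_mixture:
  assumes "0 \<le> p" "p \<le> 1"
  shows "measure_pmf.prob (bind_pmf (bernoulli_pmf p) (\<lambda>b. if b then return_pmf \<alpha> else U)) X
       = p * indicator X \<alpha> + (1 - p) * measure_pmf.prob U X"
  using assms by (simp add: prob_bind_pmf)

section \<open>The block-wise test: deterministic behaviour\<close>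

text \<open>\<open>B\<close> is the block length, \<open>Q\<close> the number of residue classes,
  \<open>A\<close> the age that counts as detection and \<open>M\<close> the offset between the
  first classes of consecutive copies. A trial must keep an average of \<open>L / 2\<close> hits per
  block.\<close>

locale needle_test =
  fixes L M A Q B :: nat
  assumes pos: "0 < A" "0 < B"
begin

text \<open>A state is the age in blocks of the running trial together with its number of hits, which
  saturates at \<open>A * L\<close>; age \<open>A\<close> is absorbing and means detection.  A trial of copy \<open>k\<close> that
  started in block \<open>b\<close> watches the residue class \<open>k * M + b\<close>; since the starting block is recovered
  from the age and the player's index, neither \<open>b\<close> nor the class is ever transmitted.\<close>

definition copy_step :: "nat \<Rightarrow> nat \<Rightarrow> nat \<times> nat \<Rightarrow> nat \<Rightarrow> nat \<times> nat" where
  "copy_step k i = (\<lambda>(a, c) v.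
     if A \<le> a then (a, c)
     else let c' = min (A * L) (c + of_bool (v mod Q = k * M + (i div B - a)))
          in if Suc i mod B = 0 then (if Suc a * L \<le> 2 * c' then (Suc a, c') else (0, 0)) else (a, c'))"

primrec copy :: "nat \<Rightarrow> (nat \<Rightarrow> nat) \<Rightarrow> nat \<Rightarrow> nat \<times> nat" where
  "copy k x 0 = (0, 0)"
| "copy k x (Suc i) = copy_step k i (copy k x i) (x i)"

definition hits :: "nat \<Rightarrow> (nat \<Rightarrow> nat) \<Rightarrow> nat \<Rightarrow> nat \<Rightarrow> nat" where
  "hits u x i j = card {h \<in> {i..<j}. x h mod Q = u}"

text \<open>The test at the end of the first \<open>a\<close> blocks after \<open>b\<close>, stated
  whether or not copy \<open>k\<close> really starts a trial in block \<open>b\<close>. It is thus a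
  pure counting event, open to the tail bounds.\<close>

definition survives :: "nat \<Rightarrow> (nat \<Rightarrow> nat) \<Rightarrow> nat \<Rightarrow> nat \<Rightarrow> bool" where
  "survives k x b a \<longleftrightarrow> a * L \<le> 2 * hits (k * M + b) x (b * B) ((b + a) * B)"

lemma copy_bounded: "copy k x i \<in> {..A} \<times> {..A * L}"
  by (induction i) (auto simp: copy_step_def Let_def split: prod.splits)

lemma hits_refl [simp]: "hits u x i i = 0"
  by (simp add: hits_def)

lemma hits_add:
  assumes "i \<le> j" "j \<le> h"
  shows "hits u x i h = hits u x i j + hits u x j h"
proof -
  have "{l \<in> {i..<h}. x l mod Q = u} = {l \<in> {i..<j}. x l mod Q = u} \<union> {l \<in> {j..<h}. x l mod Q = u}"
    using assms by auto
  moreover have "{l \<in> {i..<j}. x l mod Q = u} \<inter> {l \<in> {j..<h}. x l mod Q = u} = {}"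
    by auto
  ultimately show ?thesis
    unfolding hits_def by (simp add: card_Un_disjoint)
qed

lemma hits_Suc:
  assumes "i \<le> j"
  shows "hits u x i (Suc j) = hits u x i j + of_bool (x j mod Q = u)"
proof -
  have "{h \<in> {j..<Suc j}. x h mod Q = u} = (if x j mod Q = u then {j} else {})"
    by auto
  then have "hits u x j (Suc j) = of_bool (x j mod Q = u)"
    by (simp add: hits_def)
  then show ?thesis
    using hits_add[of i j "Suc j" u x] assms by simp
qed

lemma copy_within_block:
  assumes "copy k x (j * B) = (a, c)" "a < A" "c \<le> A * L" "r < B"
  shows "copy k x (j * B + r) = (a, min (A * L) (c + hits (k * M + (j - a)) x (j * B) (j * B + r)))"
  using assms(4)
proof (induction r)
  case 0
  then show ?case using assms by simp
next
  case (Suc r)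
  \<comment> \<open>The next position is still short of the block boundary, so no test takes
    place.\<close>
  have "Suc (j * B + r) mod B = Suc r"
    using Suc.prems by (metis add_Suc_right mod_less mod_mult_self3)
  moreover have "(j * B + r) div B = j"
    using Suc.prems by simp
  ultimately show ?case
    using Suc assms(2) by (simp add: copy_step_def Let_def hits_Suc min_def)
qed

lemma copy_block:
  assumes "copy k x (j * B) = (a, c)" "a < A" "c \<le> A * L"
  shows "copy k x (Suc j * B) =
    (let c' = min (A * L) (c + hits (k * M + (j - a)) x (j * B) (Suc j * B))
     in if Suc a * L \<le> 2 * c' then (Suc a, c') else (0, 0))"
proof -
  define i where "i = j * B + (B - 1)"
  have Suc_i: "Suc j * B = Suc i"
    using pos by (simp add: i_def)
  have i_div: "i div B = j"
    unfolding i_def by (subst div_mult_self3) (use pos in auto)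
  have mod0: "Suc i mod B = 0"
    by (simp flip: Suc_i)
  have "copy k x i = (a, min (A * L) (c + hits (k * M + (j - a)) x (j * B) i))"
    unfolding i_def using assms pos by (intro copy_within_block) auto
  moreover have "hits (k * M + (j - a)) x (j * B) (Suc i)
      = hits (k * M + (j - a)) x (j * B) i + of_bool (x i mod Q = k * M + (j - a))"
    by (rule hits_Suc) (simp add: i_def)
  moreover have "min (A * L) (min (A * L) (c + h) + e) = min (A * L) (c + (h + e))" for h e
    by simp
  ultimately show ?thesis
    using assms(2) mod0 by (simp add: copy_step_def i_div Suc_i Let_def del: mult_Suc)
qed

lemma copy_absorbed:
  assumes "fst (copy k x i) = A" "i \<le> j"
  shows "fst (copy k x j) = A"
  using assms(2,1) by (induction j rule: dec_induct) (auto simp: copy_step_def split: prod.splits)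

text \<open>At a block boundary the age reveals the starting block \<open>j - a\<close>, and the
  counter is the saturated number of hits since then. Of the tests passed, only the latest is
  recorded: this is all that the union bounds use.\<close>

lemma copy_block_invariant:
  assumes "copy k x (j * B) = (a, c)"
  shows "(a < A \<longrightarrow> a \<le> j \<and> c = min (A * L) (hits (k * M + (j - a)) x ((j - a) * B) (j * B))
            \<and> (0 < a \<longrightarrow> survives k x (j - a) a))
       \<and> (a = A \<longrightarrow> (\<exists>b. b + A \<le> j \<and> survives k x b A))"
  using assms
proof (induction j arbitrary: a c)
  case 0
  then show ?case using pos by auto
next
  case (Suc j)
  obtain a' c' where j: "copy k x (j * B) = (a', c')"
    by force
  show ?case
  proof (cases "a' = A")
    case True
    have "fst (copy k x (Suc j * B)) = A"
      by (rule copy_absorbed[of _ _ "j * B"]) (use j True in auto)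
    then have "a = A"
      using Suc.prems by simp
    then show ?thesis
      using Suc.IH[OF j] True le_SucI by blast
  next
    case False
    have bd: "a' \<le> A" "c' \<le> A * L"
      using copy_bounded[of k x "j * B"] j by auto
    then have "a' < A"
      using False by simp
    then have a': "a' \<le> j" and c': "c' = min (A * L) (hits (k * M + (j - a')) x ((j - a') * B) (j * B))"
      using Suc.IH[OF j] by auto
    define h where "h = hits (k * M + (j - a')) x ((j - a') * B) (Suc j * B)"
    have "h = hits (k * M + (j - a')) x ((j - a') * B) (j * B) + hits (k * M + (j - a')) x (j * B) (Suc j * B)"
      unfolding h_def by (rule hits_add) auto
    \<comment> \<open>Saturating, adding and saturating again is the same as saturating the
      total.\<close>
    then have h: "min (A * L) (c' + hits (k * M + (j - a')) x (j * B) (Suc j * B)) = min (A * L) h"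
      unfolding c' by (simp only: min_def) (simp split: if_splits)
    \<comment> \<open>No threshold exceeds \<open>A * L\<close>, so saturation never changes the
      outcome of a test.\<close>
    have "Suc a' * L \<le> A * L"
      using \<open>a' < A\<close> by (intro mult_le_mono1) simp
    then have pass: "Suc a' * L \<le> 2 * min (A * L) h \<longleftrightarrow> Suc a' * L \<le> 2 * h"
      by linarith
    have "(a, c) = (if Suc a' * L \<le> 2 * h then (Suc a', min (A * L) h) else (0, 0))"
      using copy_block[OF j \<open>a' < A\<close> bd(2)] Suc.prems unfolding h Let_def pass by simp
    moreover have "survives k x (j - a') (Suc a') \<longleftrightarrow> Suc a' * L \<le> 2 * h"
      unfolding survives_def h_def using a' by simp
    ultimately show ?thesis
      using a' \<open>a' < A\<close> pos by (auto simp: h_def split: if_splits intro!: exI[of _ "j - a'"])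
  qed
qed

text \<open>Ages change only at block ends, so a detection seen at time \<open>i\<close> was already
  present at the last boundary, where the invariant applies.\<close>

lemma detected_imp_survives:
  assumes "fst (copy k x i) = A"
  shows "\<exists>b. (b + A) * B \<le> i \<and> survives k x b A"
proof -
  obtain a c where ac: "copy k x (i div B * B) = (a, c)"
    by force
  have bd: "a \<le> A" "c \<le> A * L"
    using copy_bounded[of k x "i div B * B"] ac by auto
  have "a = A"
  proof (rule ccontr)
    assume "a \<noteq> A"
    then have "fst (copy k x (i div B * B + i mod B)) = a"
      using copy_within_block[OF ac, of "i mod B"] bd pos by simp
    then show False
      using assms \<open>a \<noteq> A\<close> by simp
  qed
  then obtain b where "b + A \<le> i div B" "survives k x b A"
    using copy_block_invariant[OF ac] by auto
  moreover from this(1) have "(b + A) * B \<le> i"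
    using pos by (simp add: less_eq_div_iff_mult_less_eq)
  ultimately show ?thesis by blast
qed

text \<open>By \<open>dead\<close>, no undetected earlier trial is still running when block
  \<open>b\<close> begins, so a trial starts there unless detection has already happened; by
  \<open>alive\<close> it passes all its tests.\<close>

lemma survives_imp_detected:
  assumes dead: "\<And>a. 1 \<le> a \<Longrightarrow> a \<le> b \<Longrightarrow> \<not> survives k x (b - a) a"
    and alive: "\<And>a. 1 \<le> a \<Longrightarrow> a \<le> A \<Longrightarrow> survives k x b a"
  shows "fst (copy k x ((b + A) * B)) = A"
proof -
  \<comment> \<open>The alternative \<open>A\<close> covers a copy already absorbed by an earlier
    trial, which also counts as detection.\<close>
  have "fst (copy k x ((b + a) * B)) \<in> {a, A}" if "a \<le> A" for a
    using that
  proof (induction a)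
    case 0
    obtain a c where ac: "copy k x (b * B) = (a, c)"
      by force
    then show ?case
      using copy_block_invariant[OF ac] copy_bounded[of k x "b * B"] dead[of a] by fastforce
  next
    case (Suc a)
    obtain a' c where ac: "copy k x ((b + a) * B) = (a', c)"
      by force
    show ?case
    proof (cases "a' = A")
      case True
      have "fst (copy k x ((b + Suc a) * B)) = A"
        by (rule copy_absorbed[of _ _ "(b + a) * B"]) (use ac True in auto)
      then show ?thesis by simp
    next
      case False
      then have "a' = a" "a < A"
        using Suc ac by auto
      have c: "c = min (A * L) (hits (k * M + b) x (b * B) ((b + a) * B))"
        using copy_block_invariant[OF ac] \<open>a' = a\<close> \<open>a < A\<close> by simp
      have "hits (k * M + b) x (b * B) ((b + Suc a) * B) = hits (k * M + b) x (b * B) ((b + a) * B)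
          + hits (k * M + b) x ((b + a) * B) ((b + Suc a) * B)"
        by (rule hits_add) auto
      then have h: "min (A * L) (c + hits (k * M + b) x ((b + a) * B) ((b + Suc a) * B))
          = min (A * L) (hits (k * M + b) x (b * B) ((b + Suc a) * B))"
        unfolding c by (simp only: min_def) (simp split: if_splits)
      have "Suc a * L \<le> A * L"
        using \<open>a < A\<close> by (intro mult_le_mono1) simp
      then have "Suc a * L \<le> 2 * min (A * L) (hits (k * M + b) x (b * B) ((b + Suc a) * B))"
        using alive[of "Suc a"] Suc.prems unfolding survives_def by linarith
      then show ?thesis
        using copy_block[OF ac[unfolded \<open>a' = a\<close>] \<open>a < A\<close>] h c by (simp add: Let_def)
    qed
  qed
  from this[of A] show ?thesis by simp
qed

section \<open>Error probabilities\<close>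

text \<open>With at most \<open>L / 8\<close> expected hits per block, the upper tail at
  \<open>a * L / 2\<close> has exponent at most \<open>a * L / 4 - a * L / 2\<close>.\<close>

lemma prob_survives_le:
  fixes \<rho> :: real
  assumes "(b + a) * B \<le> n"
    and "\<And>i. measure_pmf.prob (p i) {v. v mod Q = k * M + b} \<le> \<rho>" "\<rho> * B \<le> L / 8"
  shows "measure_pmf.prob (Pi_pmf {..<n} d p) {x. survives k x b a} \<le> exp (- real (a * L) / 4)"
proof -
  have sub: "{b * B..<(b + a) * B} \<subseteq> {..<n}"
    using assms(1) by auto
  have "{x. survives k x b a} = {x. real (a * L) / 2 \<le> real (card {i \<in> {b * B..<(b + a) * B}. x i mod Q = k * M + b})}"
    unfolding survives_def hits_def by (auto simp del: of_nat_mult)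
  then have "measure_pmf.prob (Pi_pmf {..<n} d p) {x. survives k x b a} \<le> exp (2 * \<rho> * card {b * B..<(b + a) * B} - real (a * L) / 2)"
    using count_Pi_pmf_upper_tail[OF _ sub, of p "\<lambda>v. v mod Q = k * M + b" \<rho> d "real (a * L) / 2"] assms(2) by simp
  also have "2 * \<rho> * card {b * B..<(b + a) * B} = 2 * real a * (\<rho> * B)"
    by (simp add: add_mult_distrib)
  also have "2 * real a * (\<rho> * B) - real (a * L) / 2 \<le> - real (a * L) / 4"
    using mult_left_mono[OF assms(3), of "2 * real a"] by (simp add: algebra_simps)
  finally show ?thesis by simp
qed

text \<open>With at least \<open>L\<close> expected hits per block, the lower tail at
  \<open>a * L / 2\<close> has exponent at most \<open>a * L / 2 - 3 / 5 * a * L\<close>; this is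
  the source of the 1/10.\<close>

lemma prob_not_survives_le:
  fixes \<rho> :: real
  assumes "(b + a) * B \<le> n"
    and "\<And>i. \<rho> \<le> measure_pmf.prob (p i) {v. v mod Q = k * M + b}" "L \<le> \<rho> * B" "0 \<le> \<rho>"
  shows "measure_pmf.prob (Pi_pmf {..<n} d p) {x. \<not> survives k x b a} \<le> exp (- real (a * L) / 10)"
proof -
  have sub: "{b * B..<(b + a) * B} \<subseteq> {..<n}"
    using assms(1) by auto
  have "measure_pmf.prob (Pi_pmf {..<n} d p) {x. \<not> survives k x b a}
      \<le> measure_pmf.prob (Pi_pmf {..<n} d p)
          {x. real (card {i \<in> {b * B..<(b + a) * B}. x i mod Q = k * M + b}) \<le> real (a * L) / 2}"
    unfolding survives_def hits_def by (intro measure_pmf.finite_measure_mono) (auto simp del: of_nat_mult)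
  also have "\<dots> \<le> exp (real (a * L) / 2 - 3 / 5 * \<rho> * card {b * B..<(b + a) * B})"
    using count_Pi_pmf_lower_tail[OF _ sub, of \<rho> p "\<lambda>v. v mod Q = k * M + b" d "real (a * L) / 2"] assms(2,4) by simp
  also have "3 / 5 * \<rho> * card {b * B..<(b + a) * B} = 3 / 5 * real a * (\<rho> * B)"
    by (simp add: add_mult_distrib)
  also have "real (a * L) / 2 - 3 / 5 * real a * (\<rho> * B) \<le> - real (a * L) / 10"
    using mult_left_mono[OF assms(3), of "3 / 5 * real a"] by (simp add: algebra_simps)
  finally show ?thesis by simp
qed

text \<open>A union bound over every copy and every starting block whose \<open>A\<close> blocks fit
  into the samples, crudely at most \<open>K * n\<close> pairs. The condition
  \<open>16 * B \<le> L * Q\<close> turns the class probability \<open>2 / Q\<close> into the rate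
  \<open>L / 8\<close> per block.\<close>

lemma prob_D0_detected_le:
  assumes "0 < Q" "Q \<le> t" "16 * B \<le> L * Q" "m \<le> n" "0 < m"
  shows "measure_pmf.prob (D0 n t) {x. \<exists>k<K. fst (copy k x m) = A} \<le> real K * real n * exp (- real (A * L) / 4)"
proof -
  define T where "T = {(k, b). k < K \<and> b < n \<and> (b + A) * B \<le> n}"
  have sub: "T \<subseteq> {..<K} \<times> {..<n}"
    by (auto simp: T_def)
  then have fin: "finite T"
    by (rule finite_subset) simp
  have rate: "2 / real Q * real B \<le> real L / 8"
    using assms(1) of_nat_mono[OF assms(3), where 'a = real] by (simp add: field_simps)
  have "{x. \<exists>k<K. fst (copy k x m) = A} \<subseteq> (\<Union>(k, b)\<in>T. {x. survives k x b A})"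
  proof safe
    fix k x assume "k < K" "fst (copy k x m) = A"
    then obtain b where b: "(b + A) * B \<le> m" "survives k x b A"
      using detected_imp_survives by blast
    have "b + A \<le> (b + A) * B"
      using pos by simp
    then have "b < n"
      using b(1) assms(4) pos by linarith
    then show "x \<in> (\<Union>(k, b)\<in>T. {x. survives k x b A})"
      using b order.trans[OF b(1) assms(4)] \<open>k < K\<close> by (auto simp: T_def)
  qed
  then have "measure_pmf.prob (D0 n t) {x. \<exists>k<K. fst (copy k x m) = A}
      \<le> measure_pmf.prob (D0 n t) (\<Union>(k, b)\<in>T. {x. survives k x b A})"
    by (intro measure_pmf.finite_measure_mono) auto
  also have "\<dots> \<le> (\<Sum>(k, b)\<in>T. measure_pmf.prob (D0 n t) {x. survives k x b A})"
    using measure_pmf.finite_measure_subadditive_finite[OF fin, of "\<lambda>(k, b). {x. survives k x b A}" "D0 n t"]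
    by (simp add: case_prod_unfold)
  also have "\<dots> \<le> (\<Sum>(k, b)\<in>T. exp (- real (A * L) / 4))"
  proof (intro sum_mono, clarify)
    fix k b assume "(k, b) \<in> T"
    then have "(b + A) * B \<le> n"
      by (simp add: T_def)
    then show "measure_pmf.prob (D0 n t) {x. survives k x b A} \<le> exp (- real (A * L) / 4)"
      unfolding D0_def by (rule prob_survives_le[OF _ prob_residue_class_le[OF assms(1,2)] rate])
  qed
  also have "\<dots> = real (card T) * exp (- real (A * L) / 4)"
    by (simp add: case_prod_unfold)
  also have "\<dots> \<le> real (K * n) * exp (- real (A * L) / 4)"
    using card_mono[OF _ sub] by (intro mult_right_mono) (auto simp del: of_nat_mult)
  finally show ?thesis by simp
qed

text \<open>Fix the needle. By \<open>Q \<le> K * M\<close> its class is assigned to some copy and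
  some block \<open>b < M\<close>, and \<open>(M + A) * B \<le> m\<close> leaves time for that
  trial. It can fail only if an earlier trial of the same copy is still running at block
  \<open>b\<close>, or if it fails one of its own tests; both failure probabilities are bounded by
  geometric sums in \<open>exp (- L / 10)\<close>, uniformly in the needle.\<close>

lemma prob_D1_undetected_le:
  fixes p :: real
  assumes "0 < Q" "Q \<le> t" "16 * B \<le> L * Q" "m \<le> n" "(M + A) * B \<le> m" "Q \<le> K * M" "0 < L"
    and p: "0 \<le> p" "p \<le> 1" "L \<le> p * B"
  shows "measure_pmf.prob (D1 n t p) {x. \<not> (\<exists>k<K. fst (copy k x m) = A)}
           \<le> 2 * (exp (- real L / 10) / (1 - exp (- real L / 10)))"
proof -
  define U where "U = pmf_of_set {1..t}"
  define r where "r = exp (- real L / 10)"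
  have r: "0 < r" "r < 1"
    using assms by (auto simp: r_def)
  have geom: "(\<Sum>a\<in>{1..N}. r ^ a) \<le> r / (1 - r)" for N :: nat
  proof -
    have "(\<Sum>a\<in>{1..N}. r ^ a) = r * (\<Sum>a<N. r ^ a)"
      by (simp add: sum_distrib_left sum.atLeast1_atMost_eq)
    also have "(\<Sum>a<N. r ^ a) \<le> 1 / (1 - r)"
      using r by (subst sum_gp_strict) (auto intro!: divide_right_mono)
    finally show ?thesis using r by simp
  qed
  have rate: "2 / real Q * real B \<le> real L / 8"
    using assms(1) of_nat_mono[OF assms(3), where 'a = real] by (simp add: field_simps)
  have main: "measure_pmf.prob (Pi_pmf {..<n} 0 (\<lambda>i. bind_pmf (bernoulli_pmf p) (\<lambda>b. if b then return_pmf \<alpha> else U)))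
      {x. \<not> (\<exists>k<K. fst (copy k x m) = A)} \<le> 2 * (r / (1 - r))" for \<alpha>
  proof -
    \<comment> \<open>Division with remainder by \<open>M\<close> locates the needle's class: copy
      \<open>k\<close>, starting block \<open>b\<close>.\<close>
    define k b where "k = \<alpha> mod Q div M" and "b = \<alpha> mod Q mod M"
    define N where "N = bind_pmf (bernoulli_pmf p) (\<lambda>b. if b then return_pmf \<alpha> else U)"
    define D where "D = Pi_pmf {..<n} 0 (\<lambda>i. N)"
    have kb: "k * M + b = \<alpha> mod Q"
      by (simp add: k_def b_def)
    have "0 < M"
      using assms(1,6) by (cases M) auto
    then have "b < M"
      by (simp add: b_def)
    have "\<alpha> mod Q < K * M"
      using assms(1,6) by (intro less_le_trans[OF mod_less_divisor])
    then have "k < K"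
      unfolding k_def by (rule less_mult_imp_div_less)
    have time: "(b + A) * B \<le> m"
      using \<open>b < M\<close> by (intro order.trans[OF mult_le_mono1 assms(5)]) simp
    \<comment> \<open>Trials started before block \<open>b\<close> watch other classes, so the
      needle adds nothing to their hits.\<close>
    have early: "measure_pmf.prob N {v. v mod Q = k * M + (b - a)} \<le> 2 / Q" if "1 \<le> a" "a \<le> b" for a
    proof -
      have "k * M + (b - a) \<noteq> \<alpha> mod Q"
        using kb that by linarith
      then have "measure_pmf.prob N {v. v mod Q = k * M + (b - a)}
          = (1 - p) * measure_pmf.prob U {v. v mod Q = k * M + (b - a)}"
        unfolding N_def using p by (simp add: prob_bernoulli_mixture indicator_def)
      also have "\<dots> \<le> 1 * measure_pmf.prob U {v. v mod Q = k * M + (b - a)}"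
        using p by (intro mult_right_mono) auto
      finally show ?thesis
        using prob_residue_class_le[OF assms(1,2), of "k * M + (b - a)"] by (simp add: U_def)
    qed
    have hot: "p \<le> measure_pmf.prob N {v. v mod Q = k * M + b}"
      unfolding N_def kb using p by (simp add: prob_bernoulli_mixture)
    have "{x. \<not> (\<exists>k<K. fst (copy k x m) = A)}
        \<subseteq> (\<Union>a\<in>{1..b}. {x. survives k x (b - a) a}) \<union> (\<Union>a\<in>{1..A}. {x. \<not> survives k x b a})"
    proof (rule subsetI, rule ccontr)
      fix x
      assume x: "x \<in> {x. \<not> (\<exists>k<K. fst (copy k x m) = A)}"
        "x \<notin> (\<Union>a\<in>{1..b}. {x. survives k x (b - a) a}) \<union> (\<Union>a\<in>{1..A}. {x. \<not> survives k x b a})"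
      have "fst (copy k x ((b + A) * B)) = A"
        by (rule survives_imp_detected) (use x(2) in auto)
      then show False
        using copy_absorbed[OF _ time] x(1) \<open>k < K\<close> by blast
    qed
    then have "measure_pmf.prob D {x. \<not> (\<exists>k<K. fst (copy k x m) = A)}
        \<le> measure_pmf.prob D ((\<Union>a\<in>{1..b}. {x. survives k x (b - a) a}) \<union> (\<Union>a\<in>{1..A}. {x. \<not> survives k x b a}))"
      by (intro measure_pmf.finite_measure_mono) auto
    also have "\<dots> \<le> measure_pmf.prob D (\<Union>a\<in>{1..b}. {x. survives k x (b - a) a})
        + measure_pmf.prob D (\<Union>a\<in>{1..A}. {x. \<not> survives k x b a})"
      by (rule measure_Un_le) auto
    also have "\<dots> \<le> (\<Sum>a\<in>{1..b}. measure_pmf.prob D {x. survives k x (b - a) a})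
        + (\<Sum>a\<in>{1..A}. measure_pmf.prob D {x. \<not> survives k x b a})"
      by (intro add_mono measure_pmf.finite_measure_subadditive_finite) auto
    also have "\<dots> \<le> (\<Sum>a\<in>{1..b}. r ^ a) + (\<Sum>a\<in>{1..A}. r ^ a)"
    proof (intro add_mono sum_mono)
      fix a assume a: "a \<in> {1..b}"
      have "(b - a + a) * B \<le> (b + A) * B"
        using a by (intro mult_le_mono1) simp
      then have "(b - a + a) * B \<le> n"
        using time assms(4) by linarith
      then have "measure_pmf.prob D {x. survives k x (b - a) a} \<le> exp (- real (a * L) / 4)"
        unfolding D_def using early[of a] rate a by (intro prob_survives_le[where \<rho> = "2 / Q"]) auto
      also have "\<dots> \<le> r ^ a"
        by (simp add: r_def flip: exp_of_nat_mult)
      finally show "measure_pmf.prob D {x. survives k x (b - a) a} \<le> r ^ a" .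
    next
      fix a assume a: "a \<in> {1..A}"
      have "(b + a) * B \<le> (b + A) * B"
        using a by (intro mult_le_mono1) simp
      then have "(b + a) * B \<le> n"
        using time assms(4) by linarith
      then have "measure_pmf.prob D {x. \<not> survives k x b a} \<le> exp (- real (a * L) / 10)"
        unfolding D_def using hot p by (intro prob_not_survives_le[where \<rho> = p]) auto
      also have "\<dots> = r ^ a"
        by (simp add: r_def flip: exp_of_nat_mult)
      finally show "measure_pmf.prob D {x. \<not> survives k x b a} \<le> r ^ a" .
    qed
    also have "\<dots> \<le> 2 * (r / (1 - r))"
      using geom[of b] geom[of A] by linarith
    finally show ?thesis
      by (simp add: D_def N_def)
  qed
  \<comment> \<open>Average the bound over the needle.\<close>
  have "measure_pmf.prob (D1 n t p) {x. \<not> (\<exists>k<K. fst (copy k x m) = A)} \<le> 2 * (r / (1 - r))"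
    unfolding D1_def prob_bind_pmf U_def[symmetric]
    by (intro measure_pmf.integral_le_const measure_pmf.integrable_const_bound[of _ 1])
       (use main in \<open>auto intro!: AE_pmfI simp del: not_ex\<close>)
  then show ?thesis
    by (simp add: r_def)
qed

section \<open>Space bound and assembly of the protocol\<close>

lemma detection_protocol:
  assumes card: "Suc A * Suc (A * L) \<le> 2 ^ w" and n: "2 \<le> n"
  shows "\<exists>msg out. messages_bounded n t msg (real (K * w)) \<and>
    (\<forall>r x. protocol_output n msg out r x \<longleftrightarrow> (\<exists>k<K. fst (copy k x (n - 1)) = A))"
proof -
  define S where "S = PiE {..<K} (\<lambda>_. {..A} \<times> {..A * L})"
  \<comment> \<open>Restriction to \<open>{..<K}\<close> makes the joint state extensional, so that
    it lies in the finite product \<open>S\<close>.\<close>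
  define st where "st = (\<lambda>x i. restrict (\<lambda>k. copy k x i) {..<K})"
  have "card S = (Suc A * Suc (A * L)) ^ K"
    unfolding S_def by (simp add: card_PiE)
  also have "\<dots> \<le> 2 ^ (K * w)"
    using power_mono[OF card, of K] by (simp only: power_mult[symmetric] mult.commute[of w K])
  finally have cardS: "card S \<le> 2 ^ (K * w)" .
  have "st x i \<in> S" for x i
    unfolding S_def st_def using copy_bounded by auto
  moreover have "finite S"
    by (simp add: S_def finite_PiE)
  moreover have "st x (Suc i) = restrict (\<lambda>k. copy_step k i (st x i k) (x i)) {..<K}" for x i
    by (auto simp: st_def restrict_def)
  moreover have "st x 0 = restrict (\<lambda>_. (0, 0)) {..<K}" for x
    by (auto simp: st_def)
  ultimately obtain msg out where "messages_bounded n t msg (real (K * w))"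
    "\<forall>r x. protocol_output n msg out r x \<longleftrightarrow> (\<exists>k<K. fst (st x (n - 1) k) = A)"
    using finite_state_protocol[of S "K * w" st "restrict (\<lambda>_. (0, 0)) {..<K}"
        "\<lambda>i s v. restrict (\<lambda>k. copy_step k i (s k) v) {..<K}" n t "\<lambda>s. \<exists>k<K. fst (s k) = A"] cardS n
    by blast
  moreover have "(\<exists>k<K. fst (st x (n - 1) k) = A) \<longleftrightarrow> (\<exists>k<K. fst (copy k x (n - 1)) = A)" for x
    by (auto simp: st_def)
  ultimately show ?thesis by auto
qed

end

text \<open>With \<open>s = 4 * L * M\<close> in the role of \<open>sqrt n\<close>, the choices are
  \<open>Q = 16 * s\<close>, \<open>B = L * s\<close> and \<open>K = 64 * L\<close>. Then
  \<open>16 * B = L * Q\<close> and \<open>Q = K * M\<close> hold with equality, and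
  \<open>p \<ge> 1 / s\<close> gives \<open>p * B \<ge> L\<close>. The one-point seed distribution
  expresses determinism.\<close>

lemma needle_protocol:
  fixes p :: real and L M A n t w :: nat
  assumes "0 < L" "0 < M" "0 < A" "2 \<le> n"
    and t: "64 * L * M \<le> t"
    and n: "(M + A) * (4 * L ^ 2 * M) \<le> n - 1"
    and p: "1 / real (4 * L * M) \<le> p" "p \<le> 1"
    and w: "Suc A * Suc (A * L) \<le> 2 ^ w"
  shows "\<exists>msg out. messages_bounded n t msg (real (64 * L * w)) \<and>
    measure_pmf.prob (pair_pmf (D0 n t) (return_pmf 0)) {(x, r). \<not> protocol_output n msg out r x}
      \<ge> 1 - 64 * real L * real n * exp (- real (A * L) / 4) \<and>
    measure_pmf.prob (pair_pmf (D1 n t p) (return_pmf 0)) {(x, r). protocol_output n msg out r x}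
      \<ge> 1 - 2 * (exp (- real L / 10) / (1 - exp (- real L / 10)))"
proof -
  interpret needle_test L M A "64 * L * M" "4 * L ^ 2 * M"
    using assms by unfold_locales auto
  define E where "E = {x. \<exists>k<64 * L. fst (copy k x (n - 1)) = A}"
  obtain msg out where "messages_bounded n t msg (real (64 * L * w))"
    and out: "\<And>r x. protocol_output n msg out r x \<longleftrightarrow> x \<in> E"
    using detection_protocol[OF w \<open>2 \<le> n\<close>, of t "64 * L"] by (auto simp: E_def)
  moreover have p0: "0 \<le> p"
    using p(1) by (rule order.trans[rotated]) simp
  have "real L \<le> p * real (4 * L ^ 2 * M)"
  proof -
    have "1 \<le> p * real (4 * L * M)"
      using p(1) \<open>0 < L\<close> \<open>0 < M\<close> by (simp add: divide_le_eq)
    from mult_left_mono[OF this, of "real L"] show ?thesis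
      by (simp add: power2_eq_square mult_ac)
  qed
  then have "measure_pmf.prob (D1 n t p) (- E) \<le> 2 * (exp (- real L / 10) / (1 - exp (- real L / 10)))"
    using prob_D1_undetected_le[of t "n - 1" n "64 * L" p] assms p0
    by (simp add: E_def Collect_neg_eq[symmetric] power2_eq_square)
  moreover have "measure_pmf.prob (D0 n t) E \<le> 64 * real L * real n * exp (- real (A * L) / 4)"
    using prob_D0_detected_le[of t "n - 1" n "64 * L"] assms
    by (simp add: E_def power2_eq_square)
  ultimately show ?thesis
    using measure_pmf.prob_compl[of E "D0 n t"] measure_pmf.prob_compl[of E "D1 n t p"]
    by (intro exI[of _ msg] exI[of _ out])
       (simp add: pair_return_pmf2 out vimage_def Compl_eq_Diff_UNIV[symmetric] Compl_eq)
qed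

section \<open>Choice of parameters and asymptotics\<close>

lemma messages_bounded_mono:
  "messages_bounded n t msg b \<Longrightarrow> b \<le> b' \<Longrightarrow> messages_bounded n t msg b'"
  unfolding messages_bounded_def by (meson order.trans)

theorem theorem1p11:
  fixes c :: real
  assumes "c > 0"
  shows "\<exists>(C::real) (N0::nat) (\<delta>::nat \<Rightarrow> real). \<delta> \<longlonglongrightarrow> 0 \<and>
    (\<forall>n t (p::real). n \<ge> N0 \<and> real t \<ge> c * real n \<and> 1 / sqrt (real n) \<le> p \<and> p \<le> 1 \<longrightarrow>
      (\<exists>(R::nat pmf) msg out.
         messages_bounded n t msg (C * log 2 (log 2 (real n)) * log 2 (log 2 (log 2 (real n)))) \<and>
         measure_pmf.prob (pair_pmf (D0 n t) R) {(x, r). \<not> protocol_output n msg out r x} \<ge> 1 - \<delta> n \<and>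
         measure_pmf.prob (pair_pmf (D1 n t p) R) {(x, r). protocol_output n msg out r x} \<ge> 1 - \<delta> n))"
proof -
  define l where "l = (\<lambda>n::nat. log 2 (log 2 (log 2 (real n))))"
  define r where "r = (\<lambda>n. exp (- (l n - 1) / 10))"
  \<comment> \<open>The first term bounds the error under \<open>D0\<close>, the second that under
    \<open>D1\<close>. In \<open>r\<close>, the 1 subtracted from \<open>l n\<close> pays for
    rounding \<open>L\<close> down.\<close>
  define \<delta> where "\<delta> = (\<lambda>n. 64 * l n / real n + 2 * (r n / (1 - r n)))"
  have \<delta>: "\<delta> \<longlonglongrightarrow> 0"
    unfolding \<delta>_def r_def l_def by real_asymp
  have "\<forall>\<^sub>F n in sequentially. 2 \<le> n"
    by (rule eventually_ge_at_top)
  moreover have "\<forall>\<^sub>F n in sequentially. 2 \<le> l n"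
    unfolding l_def by real_asymp
  \<comment> \<open>Here \<open>sqrt n + 4 * l n\<close> is an upper bound for
    \<open>s = 4 * L * M\<close>. This and the next two estimates ensure in turn that the domain has
    room for \<open>16 * s\<close> classes, that all trials fit into \<open>n - 1\<close> samples,
    and that age and counter fit into \<open>4 * log 2 (log 2 n)\<close> bits.\<close>
  moreover have "\<forall>\<^sub>F n in sequentially. 16 * (sqrt (real n) + 4 * l n) \<le> c * real n"
    unfolding l_def using assms by real_asymp
  moreover have "\<forall>\<^sub>F n in sequentially. (sqrt (real n) + 4 * l n)\<^sup>2 / 4
      + (8 * ln (real n) + 1) * l n * (sqrt (real n) + 4 * l n) \<le> real n - 1"
    unfolding l_def by real_asymp
  moreover have "\<forall>\<^sub>F n in sequentially.
      log 2 ((8 * ln (real n) + 2) * ((8 * ln (real n) + 1) * l n + 1)) + 1 \<le> 4 * log 2 (log 2 (real n))"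
    unfolding l_def by real_asymp
  ultimately have "\<forall>\<^sub>F n in sequentially. 2 \<le> n \<and> 2 \<le> l n
      \<and> 16 * (sqrt (real n) + 4 * l n) \<le> c * real n
      \<and> (sqrt (real n) + 4 * l n)\<^sup>2 / 4 + (8 * ln (real n) + 1) * l n * (sqrt (real n) + 4 * l n) \<le> real n - 1
      \<and> log 2 ((8 * ln (real n) + 2) * ((8 * ln (real n) + 1) * l n + 1)) + 1 \<le> 4 * log 2 (log 2 (real n))"
    by eventually_elim blast
  then obtain N0 where N0: "\<And>n. n \<ge> N0 \<Longrightarrow> 2 \<le> n \<and> 2 \<le> l n
      \<and> 16 * (sqrt (real n) + 4 * l n) \<le> c * real n
      \<and> (sqrt (real n) + 4 * l n)\<^sup>2 / 4 + (8 * ln (real n) + 1) * l n * (sqrt (real n) + 4 * l n) \<le> real n - 1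
      \<and> log 2 ((8 * ln (real n) + 2) * ((8 * ln (real n) + 1) * l n + 1)) + 1 \<le> 4 * log 2 (log 2 (real n))"
    unfolding eventually_sequentially by blast
  have "\<exists>msg out. messages_bounded n t msg (256 * log 2 (log 2 (real n)) * l n) \<and>
      measure_pmf.prob (pair_pmf (D0 n t) (return_pmf 0)) {(x, r). \<not> protocol_output n msg out r x} \<ge> 1 - \<delta> n \<and>
      measure_pmf.prob (pair_pmf (D1 n t p) (return_pmf 0)) {(x, r). protocol_output n msg out r x} \<ge> 1 - \<delta> n"
    if n: "n \<ge> N0" and t: "real t \<ge> c * real n" and p: "1 / sqrt (real n) \<le> p" "p \<le> 1" for n t and p :: real
  proof -
    have n2: "2 \<le> n" and l2: "2 \<le> l n"
      and ct: "16 * (sqrt (real n) + 4 * l n) \<le> c * real n"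
      and time: "(sqrt (real n) + 4 * l n)\<^sup>2 / 4 + (8 * ln (real n) + 1) * l n * (sqrt (real n) + 4 * l n) \<le> real n - 1"
      and bits: "log 2 ((8 * ln (real n) + 2) * ((8 * ln (real n) + 1) * l n + 1)) + 1 \<le> 4 * log 2 (log 2 (real n))"
      using N0[OF n] by blast+
    have ln_pos: "0 < ln (real n)"
      using n2 by simp
    have sqrt_pos: "0 < sqrt (real n)"
      using n2 by simp
    define L where "L = nat \<lfloor>l n\<rfloor>"
    \<comment> \<open>Rounding up gives \<open>s \<ge> sqrt n\<close>, at the price of an excess of
      at most \<open>4 * L\<close>.\<close>
    define M where "M = nat \<lceil>sqrt (real n) / (4 * real L)\<rceil>"
    \<comment> \<open>The factor 8 makes \<open>A * L / 4\<close> at least \<open>2 * ln n\<close>,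
      so that each false detection has probability at most \<open>1 / n^2\<close> and the union
      bound leaves \<open>64 * l n / n\<close>.\<close>
    define A where "A = nat \<lceil>8 * ln (real n)\<rceil>"
    define w where "w = nat \<lceil>log 2 (real (Suc A * Suc (A * L)))\<rceil>"
    define s where "s = 4 * real L * real M"
    have L: "real L \<le> l n" "l n - 1 \<le> real L" "0 < L"
      using l2 unfolding L_def by linarith+
    have M: "sqrt (real n) / (4 * real L) \<le> real M" "real M \<le> sqrt (real n) / (4 * real L) + 1"
      using sqrt_pos L(3) unfolding M_def
      by (simp_all add: of_nat_ceiling real_nat_ceiling_ge)
    have "0 < sqrt (real n) / (4 * real L)"
      using sqrt_pos L(3) by simp
    then have "0 < M"
      using M(1) by (cases M) auto
    have A: "8 * ln (real n) \<le> real A" "real A \<le> 8 * ln (real n) + 1"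
      using ln_pos unfolding A_def by linarith+
    have "0 < A"
      using A(1) ln_pos by (cases A) auto
    have s: "sqrt (real n) \<le> s" "s \<le> sqrt (real n) + 4 * real L"
      using M L(3) by (simp_all add: s_def field_simps)
    then have s': "s \<le> sqrt (real n) + 4 * l n" "0 < s"
      using L(1) sqrt_pos by linarith+
    have "real (64 * L * M) = 16 * s"
      by (simp add: s_def)
    also have "\<dots> \<le> 16 * (sqrt (real n) + 4 * l n)"
      using s' by simp
    also note ct
    also note t
    finally have t': "64 * L * M \<le> t"
      by (simp only: of_nat_le_iff)
    \<comment> \<open>The \<open>M\<close> starting blocks take \<open>s^2 / 4\<close>, about a
      quarter of the samples; the \<open>A\<close> further blocks take \<open>A * L * s\<close>,
      which is of lower order.\<close>
    have "real ((M + A) * (4 * L ^ 2 * M)) = s\<^sup>2 / 4 + real A * real L * s"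
      by (simp add: s_def power2_eq_square algebra_simps)
    also have "\<dots> \<le> (sqrt (real n) + 4 * l n)\<^sup>2 / 4 + (8 * ln (real n) + 1) * l n * (sqrt (real n) + 4 * l n)"
      using s' L A l2 ln_pos by (intro add_mono divide_right_mono power_mono mult_mono) auto
    also have "\<dots> \<le> real (n - 1)"
      using time n2 by (simp add: of_nat_diff)
    finally have time': "(M + A) * (4 * L ^ 2 * M) \<le> n - 1"
      by (simp only: of_nat_le_iff)
    have "1 / real (4 * L * M) \<le> 1 / sqrt (real n)"
      using s(1) sqrt_pos by (intro divide_left_mono) (auto simp: s_def \<open>0 < L\<close> \<open>0 < M\<close>)
    then have p': "1 / real (4 * L * M) \<le> p"
      using p(1) by linarith
    have "log 2 (real (Suc A * Suc (A * L))) \<le> real w"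
      unfolding w_def by (rule real_nat_ceiling_ge)
    then have "real (Suc A * Suc (A * L)) \<le> 2 powr real w"
      by (subst (asm) log_le_iff) (auto simp del: of_nat_mult of_nat_Suc)
    then have "real (Suc A * Suc (A * L)) \<le> real (2 ^ w)"
      by (simp add: powr_realpow)
    then have w: "Suc A * Suc (A * L) \<le> 2 ^ w"
      by (simp only: of_nat_le_iff)
    have "0 \<le> log 2 (real (Suc A * Suc (A * L)))"
      by (subst zero_le_log_cancel_iff) (auto simp del: of_nat_mult of_nat_Suc)
    then have "real w \<le> log 2 (real (Suc A * Suc (A * L))) + 1"
      unfolding w_def by linarith
    also have "log 2 (real (Suc A * Suc (A * L))) \<le> log 2 ((8 * ln (real n) + 2) * ((8 * ln (real n) + 1) * l n + 1))"
    proof -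
      have "real (Suc A * Suc (A * L)) = (real A + 1) * (real A * real L + 1)"
        by (simp add: algebra_simps)
      also have "\<dots> \<le> (8 * ln (real n) + 2) * ((8 * ln (real n) + 1) * l n + 1)"
      proof (rule mult_mono)
        show "real A * real L + 1 \<le> (8 * ln (real n) + 1) * l n + 1"
          using L A l2 ln_pos by (intro add_mono mult_mono) auto
      qed (use A ln_pos in auto)
      finally show ?thesis
        by (intro log_mono) (auto simp del: of_nat_mult of_nat_Suc)
    qed
    finally have w': "real w \<le> 4 * log 2 (log 2 (real n))"
      using bits by linarith
    \<comment> \<open>The constant is \<open>256 = 64 * 4\<close>: there are \<open>64 * L\<close>
      copies of at most \<open>4 * log 2 (log 2 n)\<close> bits each.\<close>
    have "real (64 * L * w) = 64 * (real w * real L)"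
      by simp
    also have "\<dots> \<le> 64 * (4 * log 2 (log 2 (real n)) * l n)"
      using w' L(1) by (intro mult_left_mono mult_mono) auto
    finally have space: "real (64 * L * w) \<le> 256 * log 2 (log 2 (real n)) * l n"
      by simp
    have r: "0 < r n" "r n < 1"
      using l2 by (auto simp: r_def)
    have "exp (- real (A * L) / 4) \<le> exp (- 2 * ln (real n))"
    proof -
      have "8 * ln (real n) * 1 \<le> real A * real L"
        using A ln_pos L(3) by (intro mult_mono) auto
      then show ?thesis by simp
    qed
    also have "\<dots> = 1 / (real n)\<^sup>2"
      using n2 by (simp add: exp_minus exp_double inverse_eq_divide)
    finally have "64 * real L * real n * exp (- real (A * L) / 4) \<le> 64 * l n * real n * (1 / (real n)\<^sup>2)"
      using L(1) l2 by (intro mult_mono) auto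
    also have "\<dots> = 64 * l n / real n"
      using n2 by (simp add: power2_eq_square)
    also have "\<dots> \<le> \<delta> n"
      using r by (simp add: \<delta>_def)
    finally have e0: "64 * real L * real n * exp (- real (A * L) / 4) \<le> \<delta> n" .
    have "exp (- real L / 10) \<le> r n"
      using L(2) by (simp add: r_def)
    then have "2 * (exp (- real L / 10) / (1 - exp (- real L / 10))) \<le> 2 * (r n / (1 - r n))"
      using r by (intro mult_left_mono frac_le) auto
    also have "\<dots> \<le> \<delta> n"
      using l2 by (simp add: \<delta>_def)
    finally have e1: "2 * (exp (- real L / 10) / (1 - exp (- real L / 10))) \<le> \<delta> n" .
    obtain msg out where
      "messages_bounded n t msg (real (64 * L * w))"
      "measure_pmf.prob (pair_pmf (D0 n t) (return_pmf 0)) {(x, r). \<not> protocol_output n msg out r x}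
        \<ge> 1 - 64 * real L * real n * exp (- real (A * L) / 4)"
      "measure_pmf.prob (pair_pmf (D1 n t p) (return_pmf 0)) {(x, r). protocol_output n msg out r x}
        \<ge> 1 - 2 * (exp (- real L / 10) / (1 - exp (- real L / 10)))"
      using needle_protocol[OF \<open>0 < L\<close> \<open>0 < M\<close> \<open>0 < A\<close> n2 t' time' p' p(2) w] by blast
    then show ?thesis
      using e0 e1 messages_bounded_mono[OF _ space] by (intro exI[of _ msg] exI[of _ out]) auto
  qed
  with \<delta> show ?thesis
    unfolding l_def by blast
qed

end
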